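(* Let $n\ge 1$. The following are equivalent: (i) $M(n)$ is the ordinary ring $\mathbb Z_n$, i.e. the equivalence relation $\sim$ on $\mathbb Z_n$ defining $M(n)$ is equality; (ii) $S_n=\{1\}$; (iii) every unit $u\in\mathbb Z_n^\times$ satisfies $u^2=1$; (iv) $n\mid 24$.
   Context: For a positive integer $n$, $\mathbb Z_n=\mathbb Z/n\mathbb Z$, $\mathbb Z_n^\times$ is its group of units, and $S_n=\{u^2:u\in\mathbb Z_n^\times\}$. $M(n)$ denotes the Marshall quotient of $\mathbb Z_n$ by $S_n$: the underlying set is the quotient of $\mathbb Z_n$ by the equivalence relation $a\sim b\iff as=bt$ for some $s,t\in S_n$; the class of $a$ is written $[a]$. The operations are $[a][b]=[ab]$, $-[a]=[-a]$, and the multivalued addition $[a]+[b]=\{[c]: cr=as+bt\text{ for some }r,s,t\in S_n\}$, with zero $[0]$ and unit $[1]$. An ordinary commutative ring is regarded as a multiring by replacing each sum $a+b$ with the singleton $\{a+b\}$. *)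

theory Defs
  imports "HOL-Algebra.IntRing"
begin

text \<open>
  Multirings as records: multiplication and unit come from the monoid record, addition returns
  the set of all sums of its two arguments.
\<close>

record 'a multiring = "'a monoid" +
  mzero :: 'a
  madd :: "'a \<Rightarrow> 'a \<Rightarrow> 'a set"
  mneg :: "'a \<Rightarrow> 'a"

definition multiring_of_ring :: "('a, 'm) ring_scheme \<Rightarrow> 'a multiring" where
  "multiring_of_ring R =
     \<lparr> carrier = carrier R, mult = mult R, one = \<one>\<^bsub>R\<^esub>,
       mzero = \<zero>\<^bsub>R\<^esub>, madd = (\<lambda>a b. {a \<oplus>\<^bsub>R\<^esub> b}), mneg = (\<lambda>a. \<ominus>\<^bsub>R\<^esub> a) \<rparr>"

definition multiring_iso :: "'a multiring \<Rightarrow> 'b multiring \<Rightarrow> ('a \<Rightarrow> 'b) set" where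
  "multiring_iso M N =
     {f. bij_betw f (carrier M) (carrier N) \<and>
         f \<one>\<^bsub>M\<^esub> = \<one>\<^bsub>N\<^esub> \<and>
         f (mzero M) = mzero N \<and>
         (\<forall>a\<in>carrier M. f (mneg M a) = mneg N (f a)) \<and>
         (\<forall>a\<in>carrier M. \<forall>b\<in>carrier M. f (a \<otimes>\<^bsub>M\<^esub> b) = f a \<otimes>\<^bsub>N\<^esub> f b) \<and>
         (\<forall>a\<in>carrier M. \<forall>b\<in>carrier M. f ` madd M a b = madd N (f a) (f b))}"

definition marshall_rel :: "('a, 'm) ring_scheme \<Rightarrow> 'a set \<Rightarrow> ('a \<times> 'a) set" where
  "marshall_rel R S =
     {(a, b). a \<in> carrier R \<and> b \<in> carrier R \<and> (\<exists>s\<in>S. \<exists>t\<in>S. a \<otimes>\<^bsub>R\<^esub> s = b \<otimes>\<^bsub>R\<^esub> t)}"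

definition marshall_class :: "('a, 'm) ring_scheme \<Rightarrow> 'a set \<Rightarrow> 'a \<Rightarrow> 'a set" where
  "marshall_class R S a = marshall_rel R S `` {a}"

text \<open>
  The operations are defined on classes by a union over all representatives.  The lemmas
  \<open>marshall_quotient_mult\<close>, \<open>marshall_quotient_neg\<close> and \<open>marshall_quotient_add\<close> below show that,
  for a multiplicative set \<open>S\<close> in a commutative ring, this does not depend on representatives.
\<close>

definition marshall_quotient :: "('a, 'm) ring_scheme \<Rightarrow> 'a set \<Rightarrow> 'a set multiring" where
  "marshall_quotient R S =
     \<lparr> carrier = carrier R // marshall_rel R S,
       mult = (\<lambda>A B. \<Union>a\<in>A. \<Union>b\<in>B. marshall_class R S (a \<otimes>\<^bsub>R\<^esub> b)),
       one = marshall_class R S \<one>\<^bsub>R\<^esub>,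
       mzero = marshall_class R S \<zero>\<^bsub>R\<^esub>,
       madd = (\<lambda>A B. \<Union>a\<in>A. \<Union>b\<in>B.
         {marshall_class R S c | c. c \<in> carrier R \<and>
            (\<exists>r\<in>S. \<exists>s\<in>S. \<exists>t\<in>S. c \<otimes>\<^bsub>R\<^esub> r = (a \<otimes>\<^bsub>R\<^esub> s) \<oplus>\<^bsub>R\<^esub> (b \<otimes>\<^bsub>R\<^esub> t))}),
       mneg = (\<lambda>A. \<Union>a\<in>A. marshall_class R S (\<ominus>\<^bsub>R\<^esub> a)) \<rparr>"

definition unit_squares :: "('a, 'm) ring_scheme \<Rightarrow> 'a set" where
  "unit_squares R = {u [^]\<^bsub>R\<^esub> (2::nat) | u. u \<in> Units R}"

text \<open>
  \<open>ZFact n\<close> is the quotient of the integers by the ideal generated by \<open>n\<close>; in contrast to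
  \<open>residue_ring n\<close> it is a ring for \<open>n = 1\<close> as well (the zero ring).
\<close>

abbreviation Zmod :: "nat \<Rightarrow> int set ring" where
  "Zmod n \<equiv> ZFact (int n)"

definition marshall_Zmod :: "nat \<Rightarrow> int set set multiring" where
  "marshall_Zmod n = marshall_quotient (Zmod n) (unit_squares (Zmod n))"


context
  fixes R :: "('a, 'm) ring_scheme" (structure) and S :: "'a set"
  assumes cring: "cring R" and submonoid: "submonoid S R"
begin

interpretation cring R by (fact cring)
interpretation S: submonoid S R by (fact submonoid)

lemma equiv_marshall_rel: "equiv (carrier R) (marshall_rel R S)"
proof (rule equivI)
  show "marshall_rel R S \<subseteq> carrier R \<times> carrier R"
    by (auto simp: marshall_rel_def)
  show "refl_on (carrier R) (marshall_rel R S)"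
    unfolding refl_on_def marshall_rel_def using S.one_closed by blast
  show "sym (marshall_rel R S)"
  proof (rule symI)
    fix a b assume "(a, b) \<in> marshall_rel R S"
    then obtain s t where "a \<in> carrier R" "b \<in> carrier R" "s \<in> S" "t \<in> S" "b \<otimes> t = a \<otimes> s"
      unfolding marshall_rel_def by auto
    then show "(b, a) \<in> marshall_rel R S"
      unfolding marshall_rel_def by blast
  qed
  show "trans (marshall_rel R S)"
  proof (rule transI)
    fix a b c assume "(a, b) \<in> marshall_rel R S" "(b, c) \<in> marshall_rel R S"
    then obtain s t s' t' where
      *: "a \<in> carrier R" "b \<in> carrier R" "c \<in> carrier R" "s \<in> S" "t \<in> S" "s' \<in> S" "t' \<in> S"
         "a \<otimes> s = b \<otimes> t" "b \<otimes> s' = c \<otimes> t'"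
      unfolding marshall_rel_def by auto
    note [simp] = *(1-3) *(4-7)[THEN S.mem_carrier]
    have "a \<otimes> (s \<otimes> s') = (a \<otimes> s) \<otimes> s'" by (simp add: m_assoc)
    also have "\<dots> = (b \<otimes> s') \<otimes> t" unfolding *(8) by (simp add: m_ac)
    also have "\<dots> = c \<otimes> (t' \<otimes> t)" unfolding *(9) by (simp add: m_assoc)
    finally show "(a, c) \<in> marshall_rel R S"
      unfolding marshall_rel_def using *(1,3) S.m_closed[OF *(4,6)] S.m_closed[OF *(7,5)]
      by blast
  qed
qed

lemma marshall_class_eq_iff:
  assumes "a \<in> carrier R" "b \<in> carrier R"
  shows "marshall_class R S a = marshall_class R S b \<longleftrightarrow> (\<exists>s\<in>S. \<exists>t\<in>S. a \<otimes> s = b \<otimes> t)"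
  using eq_equiv_class_iff[OF equiv_marshall_rel assms] assms
  by (simp add: marshall_class_def marshall_rel_def)

lemma marshall_quotient_mult:
  assumes "a \<in> carrier R" "b \<in> carrier R"
  shows "marshall_class R S a \<otimes>\<^bsub>marshall_quotient R S\<^esub> marshall_class R S b =
         marshall_class R S (a \<otimes> b)"
proof -
  have eq: "marshall_class R S (a' \<otimes> b') = marshall_class R S (a \<otimes> b)"
    if "a' \<in> marshall_class R S a" "b' \<in> marshall_class R S b" for a' b'
  proof -
    obtain s t s' t' where
      *: "a' \<in> carrier R" "b' \<in> carrier R" "s \<in> S" "t \<in> S" "s' \<in> S" "t' \<in> S"
         "a \<otimes> s = a' \<otimes> t" "b \<otimes> s' = b' \<otimes> t'"
      using \<open>a' \<in> _\<close> \<open>b' \<in> _\<close> unfolding marshall_class_def marshall_rel_def by auto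
    note [simp] = assms *(1-2) *(3-6)[THEN S.mem_carrier]
    have "(a' \<otimes> b') \<otimes> (t \<otimes> t') = (a' \<otimes> t) \<otimes> (b' \<otimes> t')" by (simp add: m_ac)
    also have "\<dots> = (a \<otimes> s) \<otimes> (b \<otimes> s')" by (simp add: *(7,8))
    also have "\<dots> = (a \<otimes> b) \<otimes> (s \<otimes> s')" by (simp add: m_ac)
    finally show ?thesis
      using S.m_closed[OF *(3,5)] S.m_closed[OF *(4,6)]
      by (subst marshall_class_eq_iff) (simp, simp, blast)
  qed
  have self: "a \<in> marshall_class R S a" "b \<in> marshall_class R S b"
    using equiv_class_self[OF equiv_marshall_rel] assms by (auto simp: marshall_class_def)
  have "(\<Union>a'\<in>marshall_class R S a. \<Union>b'\<in>marshall_class R S b. marshall_class R S (a' \<otimes> b')) =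
        marshall_class R S (a \<otimes> b)"
    by (intro UN_constant_eq[OF self(1)] UN_constant_eq[OF self(2)] ballI eq)
  then show ?thesis
    by (simp only: marshall_quotient_def monoid.simps)
qed

lemma marshall_quotient_neg:
  assumes "a \<in> carrier R"
  shows "mneg (marshall_quotient R S) (marshall_class R S a) = marshall_class R S (\<ominus> a)"
proof -
  have eq: "marshall_class R S (\<ominus> a') = marshall_class R S (\<ominus> a)"
    if "a' \<in> marshall_class R S a" for a'
  proof -
    obtain s t where *: "a' \<in> carrier R" "s \<in> S" "t \<in> S" "a \<otimes> s = a' \<otimes> t"
      using \<open>a' \<in> _\<close> unfolding marshall_class_def marshall_rel_def by auto
    have "\<ominus> a' \<otimes> t = \<ominus> a \<otimes> s"
      using * assms S.mem_carrier by (simp add: l_minus)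
    then show ?thesis
      using *(1-3) assms by (subst marshall_class_eq_iff) (simp, simp, blast)
  qed
  have self: "a \<in> marshall_class R S a"
    using equiv_class_self[OF equiv_marshall_rel] assms by (auto simp: marshall_class_def)
  have "(\<Union>a'\<in>marshall_class R S a. marshall_class R S (\<ominus> a')) = marshall_class R S (\<ominus> a)"
    by (intro UN_constant_eq[OF self] ballI eq)
  then show ?thesis
    by (simp only: marshall_quotient_def multiring.simps)
qed

lemma marshall_quotient_add:
  assumes "a \<in> carrier R" "b \<in> carrier R"
  shows "madd (marshall_quotient R S) (marshall_class R S a) (marshall_class R S b) =
         {marshall_class R S c | c. c \<in> carrier R \<and>
            (\<exists>r\<in>S. \<exists>s\<in>S. \<exists>t\<in>S. c \<otimes> r = (a \<otimes> s) \<oplus> (b \<otimes> t))}"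
proof -
  have eq: "\<exists>r\<in>S. \<exists>s\<in>S. \<exists>t\<in>S. c \<otimes> r = (a \<otimes> s) \<oplus> (b \<otimes> t)"
    if "a' \<in> marshall_class R S a" "b' \<in> marshall_class R S b" "c \<in> carrier R"
       "r \<in> S" "s \<in> S" "t \<in> S" "c \<otimes> r = (a' \<otimes> s) \<oplus> (b' \<otimes> t)" for a' b' c r s t
  proof -
    obtain p q p' q' where
      *: "a' \<in> carrier R" "b' \<in> carrier R" "p \<in> S" "q \<in> S" "p' \<in> S" "q' \<in> S"
         "a \<otimes> p = a' \<otimes> q" "b \<otimes> p' = b' \<otimes> q'"
      using \<open>a' \<in> _\<close> \<open>b' \<in> _\<close> unfolding marshall_class_def marshall_rel_def by auto
    note [simp] = assms *(1-2) that(3) *(3-6)[THEN S.mem_carrier] that(4-6)[THEN S.mem_carrier]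
    have "c \<otimes> (r \<otimes> (q \<otimes> q')) = (c \<otimes> r) \<otimes> (q \<otimes> q')" by (simp add: m_assoc)
    also have "\<dots> = (a' \<otimes> q) \<otimes> (q' \<otimes> s) \<oplus> (b' \<otimes> q') \<otimes> (q \<otimes> t)"
      unfolding that(7) by (simp add: l_distr r_distr m_ac)
    also have "\<dots> = (a \<otimes> p) \<otimes> (q' \<otimes> s) \<oplus> (b \<otimes> p') \<otimes> (q \<otimes> t)" by (simp add: *(7,8))
    also have "\<dots> = a \<otimes> (p \<otimes> (q' \<otimes> s)) \<oplus> b \<otimes> (p' \<otimes> (q \<otimes> t))" by (simp add: m_assoc)
    finally show ?thesis
      using S.m_closed[OF that(4) S.m_closed[OF *(4,6)]]
        S.m_closed[OF *(3) S.m_closed[OF *(6) that(5)]]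
        S.m_closed[OF *(5) S.m_closed[OF *(4) that(6)]]
      by blast
  qed
  have self: "a \<in> marshall_class R S a" "b \<in> marshall_class R S b"
    using equiv_class_self[OF equiv_marshall_rel] assms by (auto simp: marshall_class_def)
  show ?thesis
    unfolding marshall_quotient_def multiring.simps
  proof (intro equalityI UN_least)
    fix a' b' assume "a' \<in> marshall_class R S a" "b' \<in> marshall_class R S b"
    note eq = eq[OF this]
    show "{marshall_class R S c | c. c \<in> carrier R \<and>
            (\<exists>r\<in>S. \<exists>s\<in>S. \<exists>t\<in>S. c \<otimes> r = (a' \<otimes> s) \<oplus> (b' \<otimes> t))} \<subseteq>
          {marshall_class R S c | c. c \<in> carrier R \<and>
            (\<exists>r\<in>S. \<exists>s\<in>S. \<exists>t\<in>S. c \<otimes> r = (a \<otimes> s) \<oplus> (b \<otimes> t))}"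
      using eq by (intro Collect_mono) metis
  next
    show "{marshall_class R S c | c. c \<in> carrier R \<and>
            (\<exists>r\<in>S. \<exists>s\<in>S. \<exists>t\<in>S. c \<otimes> r = (a \<otimes> s) \<oplus> (b \<otimes> t))} \<subseteq>
          (\<Union>a'\<in>marshall_class R S a. \<Union>b'\<in>marshall_class R S b.
            {marshall_class R S c | c. c \<in> carrier R \<and>
              (\<exists>r\<in>S. \<exists>s\<in>S. \<exists>t\<in>S. c \<otimes> r = (a' \<otimes> s) \<oplus> (b' \<otimes> t))})"
      by (rule order_trans[OF UN_upper[OF self(2)] UN_upper[OF self(1)]])
  qed
qed

end

end

theory Submission
  imports Defs "HOL-Number_Theory.Cong"
begin

text \<open>
  For any submonoid \<open>S\<close> of a commutative ring, each \<open>s \<in> S\<close> is equivalent to \<open>1\<close>, because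
  \<open>s \<cdot> 1 = 1 \<cdot> s\<close>.  So the relation is equality exactly if \<open>S\<close> is trivial
  (\<open>marshall_rel_eq_Id_on_iff\<close>), and then the quotient map, which sends \<open>a\<close> to its class, only
  renames elements (\<open>marshall_class_iso_iff\<close>).  The squares of units are all \<open>1\<close> exactly if the
  submonoid that they form is trivial.  What is left is a question about integers: when does
  \<open>n\<close> divide \<open>a\<^sup>2 - 1\<close> for every \<open>a\<close> coprime to \<open>n\<close>?

  If \<open>n\<close> divides \<open>24 = 3 \<cdot> 8\<close>, it is enough to argue modulo \<open>3\<close> and modulo \<open>8\<close>, where all units
  square to \<open>1\<close> (\<open>coprime_square_cong_1_if_dvd_24\<close>).  Conversely, the unit \<open>5\<close> forces \<open>n\<close> to
  divide \<open>5\<^sup>2 - 1 = 24\<close>, unless \<open>5\<close> divides \<open>n\<close>.  To exclude that case, one uses a unit that is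
  \<open>2\<close> modulo the power of \<open>5\<close> in \<open>n\<close>: its square is \<open>4\<close> there, which is not \<open>1\<close>.  The Chinese
  remainder theorem lets one integer play both roles (\<open>dvd_24_if_coprime_squares_cong_1\<close>).
\<close>

section \<open>Marshall quotients that identify nothing\<close>

text \<open>Products of squares are squares because the ring is commutative.\<close>

lemma submonoid_unit_squares:
  assumes "cring R"
  shows "submonoid (unit_squares R) R"
proof -
  interpret cring R by (fact assms)
  show ?thesis
  proof
    show "unit_squares R \<subseteq> carrier R"
      by (auto simp: unit_squares_def)
    show "\<one>\<^bsub>R\<^esub> \<in> unit_squares R"
      unfolding unit_squares_def by (auto intro!: exI[of _ "\<one>\<^bsub>R\<^esub>"])
    show "x \<otimes>\<^bsub>R\<^esub> y \<in> unit_squares R"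
      if "x \<in> unit_squares R" "y \<in> unit_squares R" for x y
    proof -
      obtain u v where uv: "u \<in> Units R" "v \<in> Units R"
        "x = u [^]\<^bsub>R\<^esub> (2::nat)" "y = v [^]\<^bsub>R\<^esub> (2::nat)"
        using \<open>x \<in> _\<close> \<open>y \<in> _\<close> unfolding unit_squares_def by auto
      then have "x \<otimes>\<^bsub>R\<^esub> y = (u \<otimes>\<^bsub>R\<^esub> v) [^]\<^bsub>R\<^esub> (2::nat)"
        by (simp add: pow_mult_distrib m_comm Units_closed)
      then show ?thesis
        unfolding unit_squares_def using uv(1,2) by blast
    qed
  qed
qed

lemma unit_squares_trivial_iff:
  assumes "cring R"
  shows "unit_squares R = {\<one>\<^bsub>R\<^esub>} \<longleftrightarrow> (\<forall>u\<in>Units R. u [^]\<^bsub>R\<^esub> (2::nat) = \<one>\<^bsub>R\<^esub>)"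
  using submonoid.one_closed[OF submonoid_unit_squares[OF assms]]
  by (auto simp: unit_squares_def)

context
  fixes R :: "('a, 'm) ring_scheme" (structure) and S :: "'a set"
  assumes cring: "cring R" and submonoid: "submonoid S R"
begin

interpretation cring R by (fact cring)
interpretation S: submonoid S R by (fact submonoid)

text \<open>
  The elements of \<open>S\<close> are the only possible obstruction to the relation being equality: each of
  them is related to \<open>1\<close> via the multipliers \<open>1\<close> and \<open>s\<close>.
\<close>

lemma marshall_rel_eq_Id_on_iff: "marshall_rel R S = Id_on (carrier R) \<longleftrightarrow> S = {\<one>}"
proof
  assume Id: "marshall_rel R S = Id_on (carrier R)"
  have "s = \<one>" if "s \<in> S" for s
  proof -
    have "s \<otimes> \<one> = \<one> \<otimes> s"
      using that by simp
    then have "(s, \<one>) \<in> marshall_rel R S"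
      unfolding marshall_rel_def using that S.one_closed by auto
    then show ?thesis
      by (simp add: Id Id_on_iff)
  qed
  then show "S = {\<one>}"
    using S.one_closed by auto
next
  assume "S = {\<one>}"
  then show "marshall_rel R S = Id_on (carrier R)"
    by (auto simp: marshall_rel_def Id_on_iff)
qed

text \<open>
  Injectivity of the quotient map already forces the relation to be equality.  In the other
  direction equality of the relation gives \<open>S = {1}\<close>, so that classes are singletons and the
  multivalued sum, whose multipliers \<open>r\<close>, \<open>s\<close>, \<open>t\<close> are all \<open>1\<close>, has a single value.
\<close>

lemma marshall_class_iso_iff:
  "marshall_class R S \<in> multiring_iso (multiring_of_ring R) (marshall_quotient R S) \<longleftrightarrow>
   marshall_rel R S = Id_on (carrier R)"
proof
  assume "marshall_class R S \<in> multiring_iso (multiring_of_ring R) (marshall_quotient R S)"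
  then have inj: "inj_on (marshall_class R S) (carrier R)"
    by (simp add: multiring_iso_def multiring_of_ring_def bij_betw_def)
  have "a = b" if "(a, b) \<in> marshall_rel R S" for a b
  proof (rule inj_onD[OF inj])
    show "a \<in> carrier R" "b \<in> carrier R"
      using that by (auto simp: marshall_rel_def)
    then show "marshall_class R S a = marshall_class R S b"
      using that by (simp add: marshall_class_eq_iff[OF cring submonoid] marshall_rel_def)
  qed
  then show "marshall_rel R S = Id_on (carrier R)"
    using equiv_marshall_rel[OF cring submonoid]
    by (blast elim: equivE dest: refl_onD)
next
  assume Id: "marshall_rel R S = Id_on (carrier R)"
  then have S: "S = {\<one>}"
    by (simp only: marshall_rel_eq_Id_on_iff)
  have cls: "marshall_class R S a = {a}" if "a \<in> carrier R" for a
    using that by (auto simp: marshall_class_def Id)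
  have "bij_betw (marshall_class R S) (carrier R) (carrier R // marshall_rel R S)"
    unfolding bij_betw_def
    by (auto simp: inj_on_def cls quotient_def marshall_class_def[symmetric])
  moreover have "marshall_class R S ` {a \<oplus> b} =
      madd (marshall_quotient R S) (marshall_class R S a) (marshall_class R S b)"
    if "a \<in> carrier R" "b \<in> carrier R" for a b
    using that by (subst marshall_quotient_add[OF cring submonoid that]) (auto simp: S)
  ultimately show
    "marshall_class R S \<in> multiring_iso (multiring_of_ring R) (marshall_quotient R S)"
    using marshall_quotient_mult[OF cring submonoid] marshall_quotient_neg[OF cring submonoid]
    unfolding multiring_iso_def multiring_of_ring_def
    by (simp add: marshall_quotient_def)
qed

end

section \<open>Units modulo \<open>n\<close> as integers coprime to \<open>n\<close>\<close>

lemma carrier_Zmod: "carrier (Zmod n) = range (ZMod (int n))"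
  by (auto simp: ZFact_def FactRing_def A_RCOSETS_def' ZMod_def)

lemma ZMod_eq_iff: "ZMod k a = ZMod k b \<longleftrightarrow> [a = b] (mod k)"
  unfolding cong_def using ZMod_imp_zmod zmod_imp_ZMod by blast

lemma one_Zmod: "\<one>\<^bsub>Zmod n\<^esub> = ZMod (int n) 1"
  by (simp add: ZFact_def FactRing_def ZMod_def)

lemma mult_Zmod: "ZMod (int n) a \<otimes>\<^bsub>Zmod n\<^esub> ZMod (int n) b = ZMod (int n) (a * b)"
  using ideal.rcoset_mult_add[OF int.genideal_ideal, of "{int n}" a b]
  by (simp add: ZFact_def FactRing_def ZMod_def)

lemma ZMod_in_Units_iff: "ZMod (int n) a \<in> Units (Zmod n) \<longleftrightarrow> coprime a (int n)"
proof -
  interpret cring "Zmod n" by (rule ZFact_is_cring)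
  have "ZMod (int n) a \<in> Units (Zmod n) \<longleftrightarrow> (\<exists>b. [a * b = 1] (mod int n))"
    unfolding Units_def
    by (auto simp: carrier_Zmod one_Zmod mult_Zmod ZMod_eq_iff mult.commute)
  then show ?thesis
    by (simp add: coprime_iff_invertible_int)
qed

lemma square_Zmod: "ZMod (int n) a [^]\<^bsub>Zmod n\<^esub> (2::nat) = ZMod (int n) (a\<^sup>2)"
proof -
  interpret cring "Zmod n" by (rule ZFact_is_cring)
  have "ZMod (int n) a \<in> carrier (Zmod n)"
    by (simp add: carrier_Zmod)
  then show ?thesis
    by (simp add: numeral_2_eq_2 mult_Zmod)
qed

lemma Units_Zmod_square_iff:
  "(\<forall>u\<in>Units (Zmod n). u [^]\<^bsub>Zmod n\<^esub> (2::nat) = \<one>\<^bsub>Zmod n\<^esub>) \<longleftrightarrow>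
   (\<forall>a. coprime a (int n) \<longrightarrow> [a\<^sup>2 = 1] (mod int n))"
proof -
  have "u \<in> range (ZMod (int n))" if "u \<in> Units (Zmod n)" for u
    using that by (simp add: Units_def flip: carrier_Zmod)
  then show ?thesis
    by (metis (no_types, lifting) rangeE ZMod_in_Units_iff square_Zmod one_Zmod ZMod_eq_iff)
qed

section \<open>Moduli for which every unit squares to one\<close>

lemma square_cong_1_mod_3:
  fixes a :: int
  assumes "\<not> 3 dvd a"
  shows "3 dvd a\<^sup>2 - 1"
proof -
  have "3 dvd a - 1 \<or> 3 dvd a + 1"
    using assms by presburger
  then have "3 dvd (a - 1) * (a + 1)"
    by auto
  then show ?thesis
    by (simp add: algebra_simps power2_eq_square)
qed

text \<open>
  With \<open>a = 2 k + 1\<close> one has \<open>a\<^sup>2 - 1 = 4 k (k + 1)\<close>, and one of two consecutive integers is even.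
\<close>

lemma square_cong_1_mod_8:
  fixes a :: int
  assumes "odd a"
  shows "8 dvd a\<^sup>2 - 1"
proof -
  obtain k where a: "a = 2 * k + 1"
    using assms by (auto elim: oddE)
  have "even (k * (k + 1))"
    by simp
  then obtain j where "k * (k + 1) = 2 * j"
    by (elim evenE)
  then have "a\<^sup>2 - 1 = 8 * j"
    unfolding a by (simp add: algebra_simps power2_eq_square)
  then show ?thesis
    by simp
qed

text \<open>
  The parts \<open>gcd m 3\<close> and \<open>gcd m 8\<close> of \<open>m\<close> are coprime, so they may be treated separately.  Each is
  either \<open>1\<close> or has the prime \<open>3\<close> or \<open>2\<close> in common with \<open>m\<close>; that prime then does not divide \<open>a\<close>.
\<close>

lemma coprime_square_cong_1_if_dvd_24:
  fixes a m :: int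
  assumes m: "m dvd 24" and coprime: "coprime a m"
  shows "[a\<^sup>2 = 1] (mod m)"
proof -
  have "gcd m 3 dvd a\<^sup>2 - 1"
  proof (cases "3 dvd m")
    case True
    then have "\<not> 3 dvd a"
      using coprime coprime_common_divisor_int by fastforce
    then show ?thesis
      using square_cong_1_mod_3 dvd_trans gcd_dvd2 by blast
  next
    case False
    then have "gcd m 3 = 1"
      using prime_imp_coprime[of "3::int" m]
      by (simp add: coprime_commute flip: coprime_iff_gcd_eq_1)
    then show ?thesis
      by simp
  qed
  moreover have "gcd m 8 dvd a\<^sup>2 - 1"
  proof (cases "even m")
    case True
    then have "odd a"
      using coprime coprime_common_divisor_int by fastforce
    then show ?thesis
      using square_cong_1_mod_8 dvd_trans gcd_dvd2 by blast
  next
    case False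
    then have "coprime m (2 ^ 3)"
      by (simp only: coprime_power_right_iff coprime_right_2_iff_odd simp_thms)
    then show ?thesis
      by (simp flip: coprime_iff_gcd_eq_1)
  qed
  moreover have "coprime (gcd m 3) (gcd m 8)"
    by (rule coprime_divisors[of _ 3 _ 8]) (simp_all add: coprime_iff_gcd_eq_1 gcd_non_0_int)
  ultimately have "gcd m 3 * gcd m 8 dvd a\<^sup>2 - 1"
    by (rule divides_mult)
  moreover have "m dvd gcd m 3 * gcd m 8"
  proof -
    obtain p q where "m = p * q" "p dvd 3" "q dvd 8"
      using division_decomp[of m 3 8] m by auto
    then show ?thesis
      by (auto intro!: mult_dvd_mono)
  qed
  ultimately show ?thesis
    by (auto simp: cong_iff_dvd_diff intro: dvd_trans)
qed

text \<open>
  Write \<open>n = 5\<^sup>k m\<close> with \<open>5\<close> not dividing \<open>m\<close>, and test the hypothesis on a single \<open>x\<close>.  Being \<open>2\<close>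
  modulo \<open>5\<^sup>k\<close> it shows that \<open>5\<^sup>k\<close> divides \<open>3\<close>, hence \<open>k = 0\<close>; being \<open>5\<close> modulo \<open>m\<close> it shows
  that \<open>m\<close> divides \<open>24\<close>.
\<close>

lemma dvd_24_if_coprime_squares_cong_1:
  fixes n :: int
  assumes "n \<noteq> 0" and squares: "\<And>a. coprime a n \<Longrightarrow> [a\<^sup>2 = 1] (mod n)"
  shows "n dvd 24"
proof -
  define k where "k = multiplicity 5 n"
  obtain m where n: "n = 5 ^ k * m" and "\<not> 5 dvd m"
    using multiplicity_decompose'[of n 5] \<open>n \<noteq> 0\<close> unfolding k_def by auto
  then have coprime: "coprime 5 m"
    by (intro prime_imp_coprime) auto
  then obtain x where x: "[x = 2] (mod 5 ^ k)" "[x = 5] (mod m)"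
    using binary_chinese_remainder_int[of "5 ^ k" m] by auto
  have "coprime x (5 ^ k)"
    using cong_imp_coprime[OF cong_sym[OF x(1)]] by simp
  moreover have "coprime x m"
    using cong_imp_coprime[OF cong_sym[OF x(2)]] coprime by simp
  ultimately have x_square: "[x\<^sup>2 = 1] (mod n)"
    using squares n by simp
  then have "[x\<^sup>2 = 1] (mod 5 ^ k)" and x_square_m: "[x\<^sup>2 = 1] (mod m)"
    by (auto simp: n intro: cong_modulus_mult cong_dvd_modulus)
  moreover have "[x\<^sup>2 = 2\<^sup>2] (mod 5 ^ k)"
    by (rule cong_pow[OF x(1)])
  ultimately have "[2\<^sup>2 = 1] (mod (5::int) ^ k)"
    using cong_sym cong_trans by blast
  then have "(5::int) ^ k dvd 3"
    by (simp add: cong_iff_dvd_diff)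
  have "k = 0"
  proof (rule ccontr)
    assume "k \<noteq> 0"
    then have "(5::int) dvd 5 ^ k" by simp
    then have "(5::int) dvd 3" using \<open>5 ^ k dvd 3\<close> dvd_trans by blast
    then show False by simp
  qed
  have "[5\<^sup>2 = 1] (mod m)"
    using x_square_m cong_pow[OF x(2), of 2] cong_sym cong_trans by blast
  then show ?thesis
    by (simp add: n \<open>k = 0\<close> cong_iff_dvd_diff)
qed

theorem lemma3p6:
  fixes n :: nat
  assumes "n \<ge> 1"
  shows
    "(marshall_class (Zmod n) (unit_squares (Zmod n))
        \<in> multiring_iso (multiring_of_ring (Zmod n)) (marshall_Zmod n)
      \<longleftrightarrow> marshall_rel (Zmod n) (unit_squares (Zmod n)) = Id_on (carrier (Zmod n))) \<and>
     (marshall_rel (Zmod n) (unit_squares (Zmod n)) = Id_on (carrier (Zmod n))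
      \<longleftrightarrow> unit_squares (Zmod n) = {\<one>\<^bsub>Zmod n\<^esub>}) \<and>
     (unit_squares (Zmod n) = {\<one>\<^bsub>Zmod n\<^esub>}
      \<longleftrightarrow> (\<forall>u\<in>Units (Zmod n). u [^]\<^bsub>Zmod n\<^esub> (2::nat) = \<one>\<^bsub>Zmod n\<^esub>)) \<and>
     ((\<forall>u\<in>Units (Zmod n). u [^]\<^bsub>Zmod n\<^esub> (2::nat) = \<one>\<^bsub>Zmod n\<^esub>)
      \<longleftrightarrow> n dvd 24)"
proof (intro conjI)
  note cring = ZFact_is_cring[of "int n"]
  note submonoid = submonoid_unit_squares[OF cring]
  show "marshall_class (Zmod n) (unit_squares (Zmod n))
        \<in> multiring_iso (multiring_of_ring (Zmod n)) (marshall_Zmod n)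
      \<longleftrightarrow> marshall_rel (Zmod n) (unit_squares (Zmod n)) = Id_on (carrier (Zmod n))"
    unfolding marshall_Zmod_def by (rule marshall_class_iso_iff[OF cring submonoid])
  show "marshall_rel (Zmod n) (unit_squares (Zmod n)) = Id_on (carrier (Zmod n))
      \<longleftrightarrow> unit_squares (Zmod n) = {\<one>\<^bsub>Zmod n\<^esub>}"
    by (rule marshall_rel_eq_Id_on_iff[OF cring submonoid])
  show "unit_squares (Zmod n) = {\<one>\<^bsub>Zmod n\<^esub>}
      \<longleftrightarrow> (\<forall>u\<in>Units (Zmod n). u [^]\<^bsub>Zmod n\<^esub> (2::nat) = \<one>\<^bsub>Zmod n\<^esub>)"
    by (rule unit_squares_trivial_iff[OF cring])
  have "n dvd 24 \<longleftrightarrow> int n dvd 24"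
    using int_dvd_int_iff[of n 24] by simp
  then show "(\<forall>u\<in>Units (Zmod n). u [^]\<^bsub>Zmod n\<^esub> (2::nat) = \<one>\<^bsub>Zmod n\<^esub>)
      \<longleftrightarrow> n dvd 24"
    unfolding Units_Zmod_square_iff
    using assms coprime_square_cong_1_if_dvd_24 dvd_24_if_coprime_squares_cong_1[of "int n"]
    by auto
qed

end
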